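(* Let $R$ be either $3A_1\oplus A_2\oplus A_4$ or $4A_1\oplus A_5$. Then $R$ admits an isometric embedding into neither $I_{1,9}=\langle1\rangle\oplus 9\langle-1\rangle$ nor $II_{1,9}=H\oplus E_8$. In particular, there is no rational homology projective plane $S$ with only cyclic quotient singularities, $K_S$ nef and exactly $5$ singular points, whose minimal resolution $f:S'\to S$ has exceptional lattice $R$ isomorphic to $3A_1\oplus A_2\oplus A_4$ or to $4A_1\oplus A_5$.
   Context: $A_n$, $E_8$ denote the negative definite root lattices; $H$ is the even unimodular lattice of signature $(1,1)$; $\langle k\rangle$ is the rank one lattice with generator of square $k$. A rational homology projective plane is a normal projective complex surface with the same Betti numbers as $\mathbb{CP}^2$. The exceptional lattice $R$ is the sublattice of $H^2(S',\mathbb{Z})/\mathrm{torsion}$ (cup product) spanned by the classes of all irreducible exceptional curves of $f$. *)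

theory Defs
  imports Main
begin

text \<open>A lattice is represented by its rank n and its Gram matrix with respect to a
  Z-basis e_0,...,e_(n-1): the lattice is Z^n with bilinear form (x,y) |-> x^T G y.
  Entries of G outside {0..<n} x {0..<n} are irrelevant (conventionally 0).\<close>

type_synonym lat = "nat \<times> (nat \<Rightarrow> nat \<Rightarrow> int)"

definition lat_rank :: "lat \<Rightarrow> nat" where "lat_rank L = fst L"
definition lat_gram :: "lat \<Rightarrow> nat \<Rightarrow> nat \<Rightarrow> int" where "lat_gram L = snd L"

definition lat_form :: "lat \<Rightarrow> (nat \<Rightarrow> int) \<Rightarrow> (nat \<Rightarrow> int) \<Rightarrow> int" where
  "lat_form L x y = (\<Sum>k<lat_rank L. \<Sum>l<lat_rank L. x k * lat_gram L k l * y l)"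

definition lat_sum :: "lat \<Rightarrow> lat \<Rightarrow> lat" where
  "lat_sum L M = (lat_rank L + lat_rank M,
     (\<lambda>i j. if i < lat_rank L \<and> j < lat_rank L then lat_gram L i j
            else if lat_rank L \<le> i \<and> lat_rank L \<le> j
                    \<and> i < lat_rank L + lat_rank M \<and> j < lat_rank L + lat_rank M
                 then lat_gram M (i - lat_rank L) (j - lat_rank L)
            else 0))"

definition zero_lat :: lat where "zero_lat = (0, \<lambda>_ _. 0)"

definition lat_sums :: "lat list \<Rightarrow> lat" where
  "lat_sums Ls = foldr lat_sum Ls zero_lat"

definition rank1_lat :: "int \<Rightarrow> lat" where
  "rank1_lat k = (1, \<lambda>i j. if i = 0 \<and> j = 0 then k else 0)"

definition A_lat :: "nat \<Rightarrow> lat" where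
  "A_lat n = (n, \<lambda>i j. if i < n \<and> j < n then
                         (if i = j then -2 else if i + 1 = j \<or> j + 1 = i then 1 else 0)
                       else 0)"

text \<open>Negative definite E_8 (Bourbaki labelling 1..8 shifted to 0..7:
  edges 1-3, 3-4, 4-5, 5-6, 6-7, 7-8, 2-4).\<close>
definition E8_edge :: "nat \<Rightarrow> nat \<Rightarrow> bool" where
  "E8_edge i j = ((i, j) \<in> {(0,2),(2,3),(3,4),(4,5),(5,6),(6,7),(1,3)})"

definition E8_lat :: lat where
  "E8_lat = (8, \<lambda>i j. if i < 8 \<and> j < 8 then
                        (if i = j then -2 else if E8_edge i j \<or> E8_edge j i then 1 else 0)
                      else 0)"

definition H_lat :: lat where
  "H_lat = (2, \<lambda>i j. if i < 2 \<and> j < 2 \<and> i \<noteq> j then 1 else 0)"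

definition I_1_9 :: lat where
  "I_1_9 = lat_sums (rank1_lat 1 # replicate 9 (rank1_lat (-1)))"

definition II_1_9 :: lat where
  "II_1_9 = lat_sum H_lat E8_lat"

text \<open>An isometric embedding L -> M: an injective Z-linear map Z^n -> Z^m, given by the
  images v i (coordinate vectors in Z^m) of the basis vectors, preserving the forms.\<close>
definition lat_embeds :: "lat \<Rightarrow> lat \<Rightarrow> bool" where
  "lat_embeds L M \<longleftrightarrow> (\<exists>v :: nat \<Rightarrow> nat \<Rightarrow> int.
     (\<forall>i<lat_rank L. \<forall>j<lat_rank L. lat_form M (v i) (v j) = lat_gram L i j) \<and>
     (\<forall>c :: nat \<Rightarrow> int. (\<forall>k<lat_rank M. (\<Sum>i<lat_rank L. c i * v i k) = 0)
                         \<longrightarrow> (\<forall>i<lat_rank L. c i = 0)))"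

definition R1 :: lat where
  "R1 = lat_sums [A_lat 1, A_lat 1, A_lat 1, A_lat 2, A_lat 4]"

definition R2 :: lat where
  "R2 = lat_sums [A_lat 1, A_lat 1, A_lat 1, A_lat 1, A_lat 5]"

end

theory Submission
  imports Defs "Jordan_Normal_Form.Determinant"
begin

(*
  Let v_0, ..., v_(n-1) realise R, with Gram matrix G, inside a lattice M of rank n + 1 and
  determinant -1, and suppose 3 divides det G and adj G == 2 r r^T (mod 3) for an integer vector r.
  For u in M the Gram matrix of v_0, ..., v_(n-1), u is P B P^T, where B is the Gram matrix of M and P
  the coordinate matrix of these vectors, so its determinant is -(det P)^2; expanding it along the
  last row and column gives (det P)^2 == 2 (x.u)^2 (mod 3) for x = sum r_i v_i. Since 2 is not a
  square mod 3, x.u is divisible by 3 for every u, and unimodularity of M forces x into 3M, hence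
  9 divides x.x = r^T G r. For 3A_1 + A_2 + A_4 and 4A_1 + A_5 such an r exists with r^T G r = -6
  resp. -30, and both I_{1,9} and II_{1,9} have rank 10 and determinant -1.
*)

section \<open>Matrix identities\<close>

lemma mult_mat_mat:
  "mat n k (\<lambda>(i, j). f i j) * mat k m (\<lambda>(i, j). g i j)
     = mat n m (\<lambda>(i, j). \<Sum>l<k. f i l * g l j :: 'a :: semiring_0)"
  by (rule eq_matI) (auto simp: scalar_prod_def atLeast0LessThan intro!: sum.cong)

lemma transpose_mat_mat: "(mat n m (\<lambda>(i, j). f i j))\<^sup>T = mat m n (\<lambda>(j, i). f i j)"
  by (rule eq_matI) auto

lemma mat_eq_mat_iff: "mat n m f = mat n m g \<longleftrightarrow> (\<forall>i<n. \<forall>j<m. f (i, j) = g (i, j))"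
  by (auto simp: mat_eq_iff)

lemma smult_one_mat_eq_mat:
  "(k :: 'a :: semiring_1) \<cdot>\<^sub>m 1\<^sub>m n = mat n n (\<lambda>(i, j). if i = j then k else 0)"
  by (rule eq_matI) auto

lemma det_triangular_factor:
  fixes A X :: "'a :: comm_ring_1 mat"
  assumes A: "A \<in> carrier_mat n n" and X: "X \<in> carrier_mat n n"
    and X_upper: "\<And>i j. j < i \<Longrightarrow> i < n \<Longrightarrow> X $$ (i, j) = 0"
    and AX_lower: "\<And>i j. i < j \<Longrightarrow> j < n \<Longrightarrow> (A * X) $$ (i, j) = 0"
  shows "det A * (\<Prod>i<n. X $$ (i, i)) = (\<Prod>i<n. (A * X) $$ (i, i))"
proof -
  have AX: "A * X \<in> carrier_mat n n" using A X by simp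
  have "det X = (\<Prod>i<n. X $$ (i, i))"
    using det_upper_triangular[OF _ X] X_upper X
    by (auto simp: upper_triangular_def prod_list_diag_prod atLeast0LessThan)
  moreover have "det (A * X) = (\<Prod>i<n. (A * X) $$ (i, i))"
    using det_lower_triangular[OF AX_lower AX] A
    by (simp add: prod_list_diag_prod atLeast0LessThan)
  ultimately show ?thesis using det_mult[OF A X] by simp
qed

lemma adj_mat_eqI:
  fixes G K :: "'a :: idom mat"
  assumes G: "G \<in> carrier_mat n n" and K: "K \<in> carrier_mat n n"
    and GK: "G * K = det G \<cdot>\<^sub>m 1\<^sub>m n" and nonsingular: "det G \<noteq> 0"
  shows "adj_mat G = K"
proof -
  have A: "adj_mat G \<in> carrier_mat n n" by (rule adj_mat(1)[OF G])
  have "det G \<cdot>\<^sub>m K = (adj_mat G * G) * K"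
    using adj_mat(3)[OF G] K by (simp add: mult_smult_assoc_mat[OF one_carrier_mat K])
  also have "\<dots> = adj_mat G * (G * K)"
    using G K A by simp
  also have "\<dots> = det G \<cdot>\<^sub>m adj_mat G"
    unfolding GK using A by (simp add: mult_smult_distrib[OF A one_carrier_mat])
  finally have scaled: "det G \<cdot>\<^sub>m K = det G \<cdot>\<^sub>m adj_mat G" .
  show ?thesis
  proof (rule eq_matI)
    fix i j assume "i < dim_row K" "j < dim_col K"
    then have "K $$ (i, j) = adj_mat G $$ (i, j)"
      using arg_cong[OF scaled, of "\<lambda>N. N $$ (i, j)"] A K nonsingular
      by simp
    then show "adj_mat G $$ (i, j) = K $$ (i, j)" ..
  qed (use A K in auto)
qed

lemma det_bordered_mat:
  fixes G :: "'a :: idom mat" and c d :: "nat \<Rightarrow> 'a"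
  assumes G: "G \<in> carrier_mat n n" and nonsingular: "det G \<noteq> 0"
  shows "det (four_block_mat G (mat n 1 (\<lambda>(i, _). c i)) (mat 1 n (\<lambda>(_, j). d j)) (mat 1 1 (\<lambda>_. a)))
         = det G * a - (\<Sum>i<n. \<Sum>j<n. d i * adj_mat G $$ (i, j) * c j)"
proof -
  define g K C D A where "g = det G" and "K = adj_mat G" and "C = mat n 1 (\<lambda>(i, _). c i)"
    and "D = mat 1 n (\<lambda>(_, j). d j)" and "A = mat 1 1 (\<lambda>_. a)"
  define q where "q = (\<Sum>i<n. \<Sum>j<n. d i * K $$ (i, j) * c j)"
  have K: "K \<in> carrier_mat n n" and GK: "G * K = g \<cdot>\<^sub>m 1\<^sub>m n"
    using adj_mat[OF G] unfolding K_def g_def by auto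
  have C: "C \<in> carrier_mat n 1" and D: "D \<in> carrier_mat 1 n" and A: "A \<in> carrier_mat 1 1"
    unfolding C_def D_def A_def by auto
  \<comment> \<open>Right multiplication by this matrix clears the upper right block.\<close>
  define S where "S = four_block_mat (g \<cdot>\<^sub>m 1\<^sub>m n) (K * C) (0\<^sub>m 1 n) ((- g) \<cdot>\<^sub>m 1\<^sub>m 1)"
  have "G * (K * C) = g \<cdot>\<^sub>m C"
    using G K C by (simp add: assoc_mult_mat[symmetric] GK mult_smult_assoc_mat[OF one_carrier_mat C])
  then have upper_right: "G * (K * C) + C * ((- g) \<cdot>\<^sub>m 1\<^sub>m 1) = 0\<^sub>m n 1"
    using C by (intro eq_matI) (auto simp: mult_smult_distrib[OF C one_carrier_mat])
  have lower_right: "D * (K * C) + A * ((- g) \<cdot>\<^sub>m 1\<^sub>m 1) = mat 1 1 (\<lambda>_. q - g * a)"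
    using K by (intro eq_matI)
      (auto simp: C_def D_def A_def q_def scalar_prod_def atLeast0LessThan sum_distrib_left mult.assoc
        intro!: sum.cong)
  have "det (four_block_mat G C D A) * det S = det (four_block_mat G C D A * S)"
    using G C D A K by (intro det_mult[symmetric, of _ "n + 1"]) (auto simp: S_def)
  also have "four_block_mat G C D A * S
      = four_block_mat (G * (g \<cdot>\<^sub>m 1\<^sub>m n) + C * 0\<^sub>m 1 n) (G * (K * C) + C * ((- g) \<cdot>\<^sub>m 1\<^sub>m 1))
          (D * (g \<cdot>\<^sub>m 1\<^sub>m n) + A * 0\<^sub>m 1 n) (D * (K * C) + A * ((- g) \<cdot>\<^sub>m 1\<^sub>m 1))"
    unfolding S_def by (rule mult_four_block_mat[OF G C D A]) (use K C in auto)
  also have "\<dots> = four_block_mat (g \<cdot>\<^sub>m G) (0\<^sub>m n 1) (g \<cdot>\<^sub>m D) (mat 1 1 (\<lambda>_. q - g * a))"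
    unfolding upper_right lower_right using G C D A
    by (simp add: mult_smult_distrib[OF G one_carrier_mat] mult_smult_distrib[OF D one_carrier_mat])
  also have "det \<dots> = g ^ n * g * (q - g * a)"
    using G D by (subst det_four_block_mat_upper_right_zero[of _ n _ 1]) (auto simp: det_single g_def)
  finally have "det (four_block_mat G C D A) * det S = g ^ n * g * (q - g * a)" .
  moreover have "det S = g ^ n * (- g)"
    unfolding S_def using K C
    by (subst det_four_block_mat_lower_left_zero[of _ n _ 1]) (auto simp: det_single)
  ultimately have "det (four_block_mat G C D A) * (g ^ n * g) = (g * a - q) * (g ^ n * g)"
    by (simp add: algebra_simps)
  then show ?thesis
    using nonsingular unfolding g_def C_def D_def A_def q_def K_def by simp
qed

definition gram_mat :: "lat \<Rightarrow> int mat" where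
  "gram_mat L = mat (lat_rank L) (lat_rank L) (\<lambda>(i, j). lat_gram L i j)"

lemma gram_mat_carrier [simp]: "gram_mat L \<in> carrier_mat (lat_rank L) (lat_rank L)"
  by (simp add: gram_mat_def)

lemma index_gram_of_rows:
  assumes "i < k" "j < k"
  shows "(mat k (lat_rank M) (\<lambda>(i, l). w i l) * gram_mat M
            * (mat k (lat_rank M) (\<lambda>(i, l). w i l))\<^sup>T) $$ (i, j) = lat_form M (w i) (w j)"
proof -
  have "(mat k (lat_rank M) (\<lambda>(i, l). w i l) * gram_mat M
          * (mat k (lat_rank M) (\<lambda>(i, l). w i l))\<^sup>T) $$ (i, j)
      = (\<Sum>l<lat_rank M. (\<Sum>m<lat_rank M. w i m * lat_gram M m l) * w j l)"
    using assms by (simp add: transpose_mat_mat gram_mat_def mult_mat_mat)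
  also have "\<dots> = (\<Sum>l<lat_rank M. \<Sum>m<lat_rank M. w i m * lat_gram M m l * w j l)"
    by (simp add: sum_distrib_right)
  also have "\<dots> = lat_form M (w i) (w j)"
    unfolding lat_form_def by (rule sum.swap)
  finally show ?thesis .
qed

lemma lat_form_sum_left:
  "lat_form M (\<lambda>k. \<Sum>i\<in>I. r i * v i k) y = (\<Sum>i\<in>I. r i * lat_form M (v i) y)"
proof -
  have "lat_form M (\<lambda>k. \<Sum>i\<in>I. r i * v i k) y
      = (\<Sum>k<lat_rank M. \<Sum>l<lat_rank M. \<Sum>i\<in>I. r i * (v i k * lat_gram M k l * y l))"
    unfolding lat_form_def by (simp add: sum_distrib_right mult.assoc)
  also have "\<dots> = (\<Sum>k<lat_rank M. \<Sum>i\<in>I. \<Sum>l<lat_rank M. r i * (v i k * lat_gram M k l * y l))"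
    by (rule sum.cong[OF refl sum.swap])
  also have "\<dots> = (\<Sum>i\<in>I. \<Sum>k<lat_rank M. \<Sum>l<lat_rank M. r i * (v i k * lat_gram M k l * y l))"
    by (rule sum.swap)
  also have "\<dots> = (\<Sum>i\<in>I. r i * lat_form M (v i) y)"
    unfolding lat_form_def by (simp add: sum_distrib_left)
  finally show ?thesis .
qed

lemma lat_form_unit_right:
  "j < lat_rank M \<Longrightarrow> lat_form M x (\<lambda>l. if l = j then 1 else 0) = (\<Sum>k<lat_rank M. x k * lat_gram M k j)"
  unfolding lat_form_def by (simp add: if_distrib cong: if_cong)

definition lat_symmetric :: "lat \<Rightarrow> bool" where
  "lat_symmetric L \<longleftrightarrow> (\<forall>i j. lat_gram L i j = lat_gram L j i)"

lemma lat_form_sym: "lat_symmetric M \<Longrightarrow> lat_form M x y = lat_form M y x"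
  unfolding lat_form_def lat_symmetric_def
  by (subst sum.swap) (simp add: mult_ac)

section \<open>A mod 3 obstruction to embeddings of corank one\<close>

lemma dvd_coord_if_dvd_lat_form:
  fixes p :: int
  assumes unimodular: "coprime p (det (gram_mat M))" and dvd: "\<forall>y. p dvd lat_form M x y"
    and k: "k < lat_rank M"
  shows "p dvd x k"
proof -
  define m B A where "m = lat_rank M" and "B = gram_mat M" and "A = adj_mat B"
  have B: "B \<in> carrier_mat m m" unfolding B_def m_def gram_mat_def by simp
  have A: "A \<in> carrier_mat m m" and BA: "B * A = det B \<cdot>\<^sub>m 1\<^sub>m m"
    using adj_mat[OF B] unfolding A_def by auto
  have BA_entry: "(\<Sum>j<m. lat_gram M l j * A $$ (j, k)) = (if l = k then det B else 0)" if "l < m" for l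
    using arg_cong[OF BA, of "\<lambda>N. N $$ (l, k)"] that k A
    by (simp add: B_def gram_mat_def m_def scalar_prod_def atLeast0LessThan)
  have "(\<Sum>j<m. lat_form M x (\<lambda>l. if l = j then 1 else 0) * A $$ (j, k))
      = (\<Sum>j<m. \<Sum>l<m. x l * lat_gram M l j * A $$ (j, k))"
    by (simp add: lat_form_unit_right m_def sum_distrib_right)
  also have "\<dots> = (\<Sum>l<m. \<Sum>j<m. x l * lat_gram M l j * A $$ (j, k))"
    by (rule sum.swap)
  also have "\<dots> = (\<Sum>l<m. x l * (\<Sum>j<m. lat_gram M l j * A $$ (j, k)))"
    by (simp add: sum_distrib_left mult.assoc)
  also have "\<dots> = (\<Sum>l<m. if l = k then det B * x l else 0)"
    by (rule sum.cong) (auto simp: BA_entry)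
  also have "\<dots> = det B * x k"
    using k by (simp add: m_def)
  finally have "p dvd det B * x k"
    using dvd by (metis (no_types, lifting) dvd_mult2 dvd_sum)
  then show ?thesis
    using unimodular by (simp add: B_def coprime_dvd_mult_right_iff)
qed

lemma sq_dvd_lat_form_if_dvd_coords:
  fixes p :: int
  assumes "\<forall>k<lat_rank M. p dvd x k"
  shows "p ^ 2 dvd lat_form M x x"
  unfolding lat_form_def power2_eq_square
  using assms by (intro dvd_sum) (simp add: mult_dvd_mono dvd_mult2 mult.commute[of _ "lat_gram M _ _"]
      mult.assoc[symmetric])

lemma three_dvd_if_square_congruent_twice_square:
  fixes a b :: int
  assumes "3 dvd a ^ 2 - 2 * b ^ 2"
  shows "3 dvd b"
proof -
  define p q where "p = a mod 3" and "q = b mod 3"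
  have a: "a = 3 * (a div 3) + p" and b: "b = 3 * (b div 3) + q"
    unfolding p_def q_def by simp_all
  have "a ^ 2 - 2 * b ^ 2 = 3 * (3 * (a div 3) ^ 2 + 2 * (a div 3) * p - 6 * (b div 3) ^ 2 - 4 * (b div 3) * q)
      + (p ^ 2 - 2 * q ^ 2)"
    by (subst a, subst b) (simp add: algebra_simps power2_eq_square)
  then have "3 dvd p ^ 2 - 2 * q ^ 2"
    using assms by (metis dvd_add_right_iff dvd_triv_left)
  moreover have "p \<in> {0, 1, 2}" "q \<in> {0, 1, 2}" unfolding p_def q_def by auto
  ultimately have "q = 0" by (auto simp: power2_eq_square)
  then show ?thesis unfolding q_def by auto
qed

lemma bordered_gram_square:
  fixes M :: lat and G :: "int mat" and v :: "nat \<Rightarrow> nat \<Rightarrow> int"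
  assumes rank: "lat_rank M = Suc n" and M: "lat_symmetric M" "det (gram_mat M) = -1"
    and G: "G \<in> carrier_mat n n" "det G \<noteq> 0"
    and v: "\<forall>i<n. \<forall>j<n. lat_form M (v i) (v j) = G $$ (i, j)"
  obtains d where "d ^ 2 = (\<Sum>i<n. \<Sum>j<n. lat_form M (v i) u * adj_mat G $$ (i, j) * lat_form M (v j) u)
    - det G * lat_form M u u"
proof -
  define w where "w i = (if i < n then v i else u)" for i
  define P where "P = mat (Suc n) (Suc n) (\<lambda>(i, l). w i l)"
  define c where "c i = lat_form M (v i) u" for i
  have P: "P \<in> carrier_mat (Suc n) (Suc n)" unfolding P_def by simp
  have dims: "dim_row G = n" "dim_col G = n" using G(1) by auto
  let ?Gamma = "four_block_mat G (mat n 1 (\<lambda>(i, _). c i)) (mat 1 n (\<lambda>(_, j). c j))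
    (mat 1 1 (\<lambda>_. lat_form M u u))"
  have "P * gram_mat M * P\<^sup>T = ?Gamma"
  proof (rule eq_matI)
    fix i j assume "i < dim_row ?Gamma" "j < dim_col ?Gamma"
    then have ij: "i < Suc n" "j < Suc n" using dims by auto
    then have entry: "(P * gram_mat M * P\<^sup>T) $$ (i, j) = lat_form M (w i) (w j)"
      using index_gram_of_rows[OF ij, of M w] by (simp add: P_def rank)
    consider "i < n" "j < n" | "i < n" "j = n" | "i = n" "j < n" | "i = n" "j = n"
      using ij by linarith
    then show "(P * gram_mat M * P\<^sup>T) $$ (i, j) = ?Gamma $$ (i, j)"
    proof cases
      case 1
      then show ?thesis using entry v by (simp add: dims w_def)
    next
      case 2
      then show ?thesis using entry by (simp add: dims w_def c_def)
    next
      case 3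
      then show ?thesis using entry by (simp add: dims w_def c_def lat_form_sym[OF M(1), of u "v j"])
    next
      case 4
      then show ?thesis using entry by (simp add: dims w_def)
    qed
  qed (use dims P in auto)
  moreover have "det (P * gram_mat M * P\<^sup>T) = - (det P * det P)"
    using P M(2) gram_mat_carrier[of M] by (simp add: rank det_mult[of _ "Suc n"] det_transpose)
  ultimately have "det G * lat_form M u u - (\<Sum>i<n. \<Sum>j<n. c i * adj_mat G $$ (i, j) * c j)
      = - (det P * det P)"
    using det_bordered_mat[OF G] by simp
  then show ?thesis
    by (intro that[of "det P"]) (simp add: c_def power2_eq_square)
qed

lemma three_dvd_glue_pairing:
  fixes M :: lat and G :: "int mat" and v :: "nat \<Rightarrow> nat \<Rightarrow> int" and r :: "nat \<Rightarrow> int"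
  assumes rank: "lat_rank M = Suc n" and M: "lat_symmetric M" "det (gram_mat M) = -1"
    and G: "G \<in> carrier_mat n n" "det G \<noteq> 0" "3 dvd det G"
    and adj: "\<forall>i<n. \<forall>j<n. 3 dvd adj_mat G $$ (i, j) - 2 * r i * r j"
    and v: "\<forall>i<n. \<forall>j<n. lat_form M (v i) (v j) = G $$ (i, j)"
  shows "3 dvd (\<Sum>i<n. r i * lat_form M (v i) u)"
proof -
  define c where "c i = lat_form M (v i) u" for i
  define q where "q = (\<Sum>i<n. \<Sum>j<n. c i * adj_mat G $$ (i, j) * c j)"
  define s where "s = (\<Sum>i<n. r i * c i)"
  obtain d where square: "d ^ 2 = q - det G * lat_form M u u"
    using bordered_gram_square[OF rank M G(1,2) v] unfolding q_def c_def .
  have "q - 2 * s ^ 2 = (\<Sum>i<n. \<Sum>j<n. c i * (adj_mat G $$ (i, j) - 2 * r i * r j) * c j)"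
    by (simp add: q_def s_def power2_eq_square sum_product sum_distrib_left sum_subtractf[symmetric]
        algebra_simps)
  also have "3 dvd \<dots>"
    using adj by (intro dvd_sum) auto
  finally have "3 dvd (q - 2 * s ^ 2) - det G * lat_form M u u"
    by (rule dvd_diff) (simp add: G(3))
  also have "(q - 2 * s ^ 2) - det G * lat_form M u u = d ^ 2 - 2 * s ^ 2"
    using square by simp
  finally show ?thesis
    unfolding s_def c_def by (rule three_dvd_if_square_congruent_twice_square)
qed

lemma not_lat_embeds_mod3:
  fixes R M :: lat and r :: "nat \<Rightarrow> int"
  assumes rank: "lat_rank M = Suc (lat_rank R)" and M: "lat_symmetric M" "det (gram_mat M) = -1"
    and R: "det (gram_mat R) \<noteq> 0" "3 dvd det (gram_mat R)"
    and adj: "\<forall>i<lat_rank R. \<forall>j<lat_rank R. 3 dvd adj_mat (gram_mat R) $$ (i, j) - 2 * r i * r j"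
    and glue: "\<not> 9 dvd (\<Sum>i<lat_rank R. \<Sum>j<lat_rank R. r i * gram_mat R $$ (i, j) * r j)"
  shows "\<not> lat_embeds R M"
proof
  assume "lat_embeds R M"
  then obtain v where v: "\<forall>i<lat_rank R. \<forall>j<lat_rank R. lat_form M (v i) (v j) = lat_gram R i j"
    unfolding lat_embeds_def by blast
  define n where "n = lat_rank R"
  define x where "x k = (\<Sum>i<n. r i * v i k)" for k
  have "3 dvd lat_form M x u" for u
    unfolding x_def lat_form_sum_left n_def
    using three_dvd_glue_pairing[OF rank M _ R adj] v by (simp add: gram_mat_def)
  then have "\<forall>k<lat_rank M. 3 dvd x k"
    using M(2) dvd_coord_if_dvd_lat_form[of 3 M x] by simp
  then have "3 ^ 2 dvd lat_form M x x" by (rule sq_dvd_lat_form_if_dvd_coords)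
  moreover have "lat_form M x x = (\<Sum>i<n. \<Sum>j<n. r i * gram_mat R $$ (i, j) * r j)"
  proof -
    have "lat_form M x x = (\<Sum>i<n. \<Sum>j<n. r i * r j * lat_gram R j i)"
      unfolding x_def lat_form_sum_left lat_form_sym[OF M(1), of _ "\<lambda>k. \<Sum>i<n. r i * v i k"]
      using v by (simp add: n_def sum_distrib_left mult.assoc)
    also have "\<dots> = (\<Sum>i<n. \<Sum>j<n. r i * gram_mat R $$ (i, j) * r j)"
      by (subst sum.swap) (simp add: gram_mat_def n_def mult_ac)
    finally show ?thesis .
  qed
  ultimately show False using glue by (simp add: n_def)
qed

section \<open>Orthogonal sums, root lattices and the two targets\<close>

lemma lat_rank_lat_sum [simp]: "lat_rank (lat_sum L M) = lat_rank L + lat_rank M"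
  by (simp add: lat_sum_def lat_rank_def)

lemma gram_mat_lat_sum:
  "gram_mat (lat_sum L M) = four_block_mat (gram_mat L) (0\<^sub>m (lat_rank L) (lat_rank M))
     (0\<^sub>m (lat_rank M) (lat_rank L)) (gram_mat M)"
  by (rule eq_matI) (auto simp: gram_mat_def lat_sum_def lat_gram_def lat_rank_def)

lemma det_gram_lat_sum [simp]: "det (gram_mat (lat_sum L M)) = det (gram_mat L) * det (gram_mat M)"
  unfolding gram_mat_lat_sum
  by (rule det_four_block_mat_lower_left_zero) (auto simp: gram_mat_def)

lemma lat_symmetric_lat_sum [simp]:
  "lat_symmetric L \<Longrightarrow> lat_symmetric M \<Longrightarrow> lat_symmetric (lat_sum L M)"
  by (auto simp: lat_symmetric_def lat_sum_def lat_gram_def)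

lemma lat_rank_zero_lat [simp]: "lat_rank zero_lat = 0"
  by (simp add: zero_lat_def lat_rank_def)

lemma lat_sums_Nil [simp]: "lat_sums [] = zero_lat"
  and lat_sums_Cons [simp]: "lat_sums (L # Ls) = lat_sum L (lat_sums Ls)"
  by (simp_all add: lat_sums_def)

lemma det_gram_zero_lat [simp]: "det (gram_mat zero_lat) = 1"
  by (simp add: gram_mat_def)

lemma lat_symmetric_zero_lat [simp]: "lat_symmetric zero_lat"
  by (simp add: lat_symmetric_def zero_lat_def lat_gram_def)

lemma lat_rank_rank1_lat [simp]: "lat_rank (rank1_lat k) = 1"
  by (simp add: rank1_lat_def lat_rank_def)

lemma det_gram_rank1_lat [simp]: "det (gram_mat (rank1_lat k)) = k"
  by (simp add: det_single gram_mat_def rank1_lat_def lat_rank_def lat_gram_def)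

lemma lat_symmetric_rank1_lat [simp]: "lat_symmetric (rank1_lat k)"
  by (simp add: lat_symmetric_def rank1_lat_def lat_gram_def)

lemma lat_rank_A_lat [simp]: "lat_rank (A_lat n) = n"
  by (simp add: A_lat_def lat_rank_def)

lemma prod_shift_int: "(\<Prod>i<n. int i + 2) = (int n + 1) * (\<Prod>i<n. int i + 1)"
  by (induction n) (simp_all add: algebra_simps)

lemma det_gram_A_lat [simp]: "det (gram_mat (A_lat n)) = (-1) ^ n * (int n + 1)"
proof -
  define G where "G = gram_mat (A_lat n)"
  define X :: "int mat" where "X = mat n n (\<lambda>(i, j). if i \<le> j then - (int i + 1) else 0)"
  have G: "G \<in> carrier_mat n n" and X: "X \<in> carrier_mat n n"
    unfolding G_def gram_mat_def X_def by simp_all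
  have GX: "(G * X) $$ (i, j) = (if i = j then int i + 2 else 0)" if "i \<le> j" "j < n" for i j
  proof -
    have "(G * X) $$ (i, j) = (\<Sum>l<n. (if l = i then -2 * X $$ (l, j) else 0)
        + (if l = Suc i then X $$ (l, j) else 0) + (if Suc l = i then X $$ (l, j) else 0))"
      using that G X
      by (auto simp: G_def gram_mat_def A_lat_def lat_rank_def lat_gram_def scalar_prod_def
          atLeast0LessThan intro!: sum.cong)
    also have "\<dots> = -2 * X $$ (i, j) + (if Suc i < n then X $$ (Suc i, j) else 0)
        + (if i = 0 then 0 else X $$ (i - 1, j))"
      using that by (cases i) (simp_all add: sum.distrib)
    also have "\<dots> = (if i = j then int i + 2 else 0)"
      using that by (auto simp: X_def)
    finally show ?thesis .
  qed
  have "det G * (\<Prod>i<n. X $$ (i, i)) = (\<Prod>i<n. (G * X) $$ (i, i))"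
    by (rule det_triangular_factor[OF G X]) (simp add: X_def, simp add: GX)
  moreover have "(\<Prod>i<n. X $$ (i, i)) = (-1) ^ n * (\<Prod>i<n. int i + 1)"
  proof -
    have "(\<Prod>i<n. X $$ (i, i)) = (\<Prod>i<n. - 1 * (int i + 1))"
      by (rule prod.cong) (auto simp: X_def)
    then show ?thesis by (simp only: prod.distrib) simp
  qed
  moreover have "(\<Prod>i<n. (G * X) $$ (i, i)) = (int n + 1) * (\<Prod>i<n. int i + 1)"
    unfolding prod_shift_int[symmetric] by (rule prod.cong) (auto simp: GX)
  ultimately have "(det G * (-1) ^ n) * (\<Prod>i<n. int i + 1) = (int n + 1) * (\<Prod>i<n. int i + 1)"
    by (simp add: mult.assoc)
  then have "det G * (-1) ^ n = int n + 1"
    by (simp add: prod_pos)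
  then have "det G * ((-1) ^ n * (-1) ^ n) = (-1) ^ n * (int n + 1)"
    by (metis mult.assoc mult.commute)
  then show ?thesis
    unfolding G_def by (simp add: power_mult_distrib[symmetric])
qed

lemma lat_rank_H_lat [simp]: "lat_rank H_lat = 2"
  by (simp add: H_lat_def lat_rank_def)

lemma lat_symmetric_H_lat [simp]: "lat_symmetric H_lat"
  by (auto simp: lat_symmetric_def H_lat_def lat_gram_def)

lemma det_gram_H_lat [simp]: "det (gram_mat H_lat) = -1"
proof -
  have "gram_mat H_lat = four_block_mat (mat 1 1 (\<lambda>_. 0)) (mat 1 1 (\<lambda>_. 1)) (mat 1 1 (\<lambda>_. 1)) (0\<^sub>m 1 1)"
    by (rule eq_matI) (auto simp: gram_mat_def H_lat_def lat_rank_def lat_gram_def)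
  then show ?thesis
    by (simp add: det_four_block_mat_lower_right_zero_col[of _ 1] det_single)
qed

lemma lat_rank_E8_lat [simp]: "lat_rank E8_lat = 8"
  by (simp add: E8_lat_def lat_rank_def)

lemma lat_symmetric_E8_lat [simp]: "lat_symmetric E8_lat"
  by (auto simp: lat_symmetric_def E8_lat_def lat_gram_def)

lemma det_gram_E8_lat [simp]: "det (gram_mat E8_lat) = 1"
proof -
  define X :: "int mat" where "X = mat_of_rows_list 8
    [[-1, 0, -1, -2, -2, -2, -2, -2], [0, -1, 0, -3, -3, -3, -3, -3], [0, 0, -2, -4, -4, -4, -4, -4],
     [0, 0, 0, -6, -6, -6, -6, -6], [0, 0, 0, 0, -5, -5, -5, -5], [0, 0, 0, 0, 0, -4, -4, -4],
     [0, 0, 0, 0, 0, 0, -3, -3], [0, 0, 0, 0, 0, 0, 0, -2]]"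
  have G: "gram_mat E8_lat \<in> carrier_mat 8 8" and X: "X \<in> carrier_mat 8 8"
    by (simp_all add: gram_mat_def X_def mat_of_rows_list_def numeral_eq_Suc)
  have GX: "gram_mat E8_lat * X = mat_of_rows_list 8
    [[2, 0, 0, 0, 0, 0, 0, 0], [0, 2, 0, 0, 0, 0, 0, 0], [-1, 0, 3, 0, 0, 0, 0, 0], [0, -1, -2, 5, 0, 0, 0, 0],
     [0, 0, 0, -6, 4, 0, 0, 0], [0, 0, 0, 0, -5, 3, 0, 0], [0, 0, 0, 0, 0, -4, 2, 0], [0, 0, 0, 0, 0, 0, -3, 1]]"
    unfolding X_def mat_of_rows_list_def gram_mat_def
    by (simp add: mult_mat_mat mat_eq_mat_iff E8_lat_def E8_edge_def lat_rank_def lat_gram_def numeral_eq_Suc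
        All_less_Suc)
  have "det (gram_mat E8_lat) * (\<Prod>i<8. X $$ (i, i)) = (\<Prod>i<8. (gram_mat E8_lat * X) $$ (i, i))"
  proof (rule det_triangular_factor[OF G X])
    fix i j :: nat assume "j < i" "i < 8"
    then show "X $$ (i, j) = 0"
      by (auto simp: X_def mat_of_rows_list_def numeral_eq_Suc less_Suc_eq)
  next
    fix i j :: nat assume "i < j" "j < 8"
    then show "(gram_mat E8_lat * X) $$ (i, j) = 0"
      unfolding GX by (auto simp: mat_of_rows_list_def numeral_eq_Suc less_Suc_eq)
  qed
  then show ?thesis
    unfolding GX by (simp add: X_def mat_of_rows_list_def numeral_eq_Suc)
qed

lemma lat_rank_I_1_9 [simp]: "lat_rank I_1_9 = 10"
  and lat_symmetric_I_1_9 [simp]: "lat_symmetric I_1_9"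
  and det_gram_I_1_9 [simp]: "det (gram_mat I_1_9) = -1"
  by (simp_all add: I_1_9_def numeral_eq_Suc)

lemma lat_rank_II_1_9 [simp]: "lat_rank II_1_9 = 10"
  and lat_symmetric_II_1_9 [simp]: "lat_symmetric II_1_9"
  and det_gram_II_1_9 [simp]: "det (gram_mat II_1_9) = -1"
  by (simp_all add: II_1_9_def)

section \<open>The two exceptional lattices\<close>

lemma lat_rank_R1 [simp]: "lat_rank R1 = 9"
  and det_gram_R1: "det (gram_mat R1) = -120"
  by (simp_all add: R1_def)

lemma lat_rank_R2 [simp]: "lat_rank R2 = 9"
  and det_gram_R2: "det (gram_mat R2) = -96"
  by (simp_all add: R2_def)

lemma gram_mat_R1: "gram_mat R1 = mat_of_rows_list 9
  [[-2, 0, 0, 0, 0, 0, 0, 0, 0], [0, -2, 0, 0, 0, 0, 0, 0, 0], [0, 0, -2, 0, 0, 0, 0, 0, 0],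
   [0, 0, 0, -2, 1, 0, 0, 0, 0], [0, 0, 0, 1, -2, 0, 0, 0, 0], [0, 0, 0, 0, 0, -2, 1, 0, 0],
   [0, 0, 0, 0, 0, 1, -2, 1, 0], [0, 0, 0, 0, 0, 0, 1, -2, 1], [0, 0, 0, 0, 0, 0, 0, 1, -2]]"
  unfolding gram_mat_def mat_of_rows_list_def
  by (simp add: mat_eq_mat_iff R1_def lat_sum_def lat_rank_def lat_gram_def A_lat_def zero_lat_def
      numeral_eq_Suc All_less_Suc)

lemma gram_mat_R2: "gram_mat R2 = mat_of_rows_list 9
  [[-2, 0, 0, 0, 0, 0, 0, 0, 0], [0, -2, 0, 0, 0, 0, 0, 0, 0], [0, 0, -2, 0, 0, 0, 0, 0, 0],
   [0, 0, 0, -2, 0, 0, 0, 0, 0], [0, 0, 0, 0, -2, 1, 0, 0, 0], [0, 0, 0, 0, 1, -2, 1, 0, 0],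
   [0, 0, 0, 0, 0, 1, -2, 1, 0], [0, 0, 0, 0, 0, 0, 1, -2, 1], [0, 0, 0, 0, 0, 0, 0, 1, -2]]"
  unfolding gram_mat_def mat_of_rows_list_def
  by (simp add: mat_eq_mat_iff R2_def lat_sum_def lat_rank_def lat_gram_def A_lat_def zero_lat_def
      numeral_eq_Suc All_less_Suc)

lemma adj_gram_R1: "adj_mat (gram_mat R1) = mat_of_rows_list 9
  [[60, 0, 0, 0, 0, 0, 0, 0, 0], [0, 60, 0, 0, 0, 0, 0, 0, 0], [0, 0, 60, 0, 0, 0, 0, 0, 0],
   [0, 0, 0, 80, 40, 0, 0, 0, 0], [0, 0, 0, 40, 80, 0, 0, 0, 0], [0, 0, 0, 0, 0, 96, 72, 48, 24],
   [0, 0, 0, 0, 0, 72, 144, 96, 48], [0, 0, 0, 0, 0, 48, 96, 144, 72], [0, 0, 0, 0, 0, 24, 48, 72, 96]]"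
  (is "_ = ?K")
proof (rule adj_mat_eqI)
  show "gram_mat R1 \<in> carrier_mat 9 9" using gram_mat_carrier[of R1] by simp
  show "?K \<in> carrier_mat 9 9" by (simp add: mat_of_rows_list_def numeral_eq_Suc)
  show "det (gram_mat R1) \<noteq> 0" by (simp add: det_gram_R1)
  show "gram_mat R1 * ?K = det (gram_mat R1) \<cdot>\<^sub>m 1\<^sub>m 9"
    unfolding det_gram_R1 unfolding gram_mat_R1 smult_one_mat_eq_mat mat_of_rows_list_def
    by (simp add: mult_mat_mat mat_eq_mat_iff numeral_eq_Suc All_less_Suc)
qed

lemma adj_gram_R2: "adj_mat (gram_mat R2) = mat_of_rows_list 9
  [[48, 0, 0, 0, 0, 0, 0, 0, 0], [0, 48, 0, 0, 0, 0, 0, 0, 0], [0, 0, 48, 0, 0, 0, 0, 0, 0],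
   [0, 0, 0, 48, 0, 0, 0, 0, 0], [0, 0, 0, 0, 80, 64, 48, 32, 16], [0, 0, 0, 0, 64, 128, 96, 64, 32],
   [0, 0, 0, 0, 48, 96, 144, 96, 48], [0, 0, 0, 0, 32, 64, 96, 128, 64], [0, 0, 0, 0, 16, 32, 48, 64, 80]]"
  (is "_ = ?K")
proof (rule adj_mat_eqI)
  show "gram_mat R2 \<in> carrier_mat 9 9" using gram_mat_carrier[of R2] by simp
  show "?K \<in> carrier_mat 9 9" by (simp add: mat_of_rows_list_def numeral_eq_Suc)
  show "det (gram_mat R2) \<noteq> 0" by (simp add: det_gram_R2)
  show "gram_mat R2 * ?K = det (gram_mat R2) \<cdot>\<^sub>m 1\<^sub>m 9"
    unfolding det_gram_R2 unfolding gram_mat_R2 smult_one_mat_eq_mat mat_of_rows_list_def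
    by (simp add: mult_mat_mat mat_eq_mat_iff numeral_eq_Suc All_less_Suc)
qed

(* glue_R1 / 3 and glue_R2 / 3 lie in the dual lattice and span its 3-primary part, which sits in
   the A_2 resp. A_5 summand. *)
definition glue_R1 :: "nat \<Rightarrow> int" where "glue_R1 i = [0, 0, 0, 1, 2, 0, 0, 0, 0] ! i"

definition glue_R2 :: "nat \<Rightarrow> int" where "glue_R2 i = [0, 0, 0, 0, 1, 2, 3, 4, 5] ! i"

lemma not_lat_embeds_R1:
  assumes "lat_rank M = 10" "lat_symmetric M" "det (gram_mat M) = -1"
  shows "\<not> lat_embeds R1 M"
proof (rule not_lat_embeds_mod3[where r = glue_R1])
  show "\<forall>i<lat_rank R1. \<forall>j<lat_rank R1. 3 dvd adj_mat (gram_mat R1) $$ (i, j) - 2 * glue_R1 i * glue_R1 j"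
    by (simp add: adj_gram_R1 mat_of_rows_list_def glue_R1_def numeral_eq_Suc All_less_Suc)
  show "\<not> 9 dvd (\<Sum>i<lat_rank R1. \<Sum>j<lat_rank R1. glue_R1 i * gram_mat R1 $$ (i, j) * glue_R1 j)"
    by (simp add: gram_mat_R1 mat_of_rows_list_def glue_R1_def numeral_eq_Suc)
qed (simp_all add: assms det_gram_R1)

lemma not_lat_embeds_R2:
  assumes "lat_rank M = 10" "lat_symmetric M" "det (gram_mat M) = -1"
  shows "\<not> lat_embeds R2 M"
proof (rule not_lat_embeds_mod3[where r = glue_R2])
  show "\<forall>i<lat_rank R2. \<forall>j<lat_rank R2. 3 dvd adj_mat (gram_mat R2) $$ (i, j) - 2 * glue_R2 i * glue_R2 j"
    by (simp add: adj_gram_R2 mat_of_rows_list_def glue_R2_def numeral_eq_Suc All_less_Suc)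
  show "\<not> 9 dvd (\<Sum>i<lat_rank R2. \<Sum>j<lat_rank R2. glue_R2 i * gram_mat R2 $$ (i, j) * glue_R2 j)"
    by (simp add: gram_mat_R2 mat_of_rows_list_def glue_R2_def numeral_eq_Suc)
qed (simp_all add: assms det_gram_R2)

theorem lemma6p8:
  shows "\<forall>R \<in> {R1, R2}. \<not> lat_embeds R I_1_9 \<and> \<not> lat_embeds R II_1_9"
  by (simp add: not_lat_embeds_R1 not_lat_embeds_R2)

end
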